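(* Every coherent canonical system $\mathbf G$ admits strong cut-elimination: for every set $\mathcal{S}$ of sequents and every sequent $s$, if $\mathcal{S}\vdash^{seq}_{\mathbf G}s$ then there exists an $\mathcal{S}$-proof of $s$ from $\mathcal{S}$ in $\mathbf G$.
   Context: Syntax. $\mathcal{L}$ is a propositional language with atoms $p_1,p_2,\ldots$ and set of formulas $\mathcal{F}$. A sequent is $\Gamma\Rightarrow E$ with $\Gamma$ a finite set of formulas and $E$ a set of formulas with at most one element. A clause is a sequent of atoms. An $\mathcal{L}$-substitution is a map $\sigma:\mathcal{F}\to\mathcal{F}$ commuting with all connectives, extended pointwise to sets. A canonical right-introduction rule for an $n$-ary connective $\diamond$ is $\{\Pi_i\Rightarrow E_i\}_{1\le i\le m}/\ \Rightarrow\diamond(p_1,\dots,p_n)$ with $m\ge0$ and $\Pi_i\cup E_i\subseteq\{p_1,\dots,p_n\}$; an application infers $\Gamma\Rightarrow\sigma(\diamond(p_1,\dots,p_n))$ from $\Gamma,\sigma(\Pi_i)\Rightarrow\sigma(E_i)$ ($1\le i\le m$), for any finite $\Gamma$ and substitution $\sigma$. A canonical left-introduction rule is $\langle\{\Pi_i\Rightarrow E_i\}_{1\le i\le m},\{\Sigma_j\Rightarrow\}_{1\le j\le k}\rangle/\ \diamond(p_1,\dots,p_n)\Rightarrow$ with all atoms among $p_1,\dots,p_n$ (hard premises $\Pi_i\Rightarrow E_i$, soft premises $\Sigma_j\Rightarrow$); an application infers $\Gamma,\sigma(\diamond(p_1,\dots,p_n))\Rightarrow E$ from $\Gamma,\sigma(\Pi_i)\Rightarrow\sigma(E_i)$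 and $\Gamma,\sigma(\Sigma_j)\Rightarrow E$, for any sequent $\Gamma\Rightarrow E$ and substitution $\sigma$. A canonical system has axioms $\varphi\Rightarrow\varphi$, weakening (from $\Gamma\Rightarrow E$ infer $\Gamma,\Delta\Rightarrow E$; from $\Gamma\Rightarrow$ infer $\Gamma\Rightarrow\psi$), cut (from $\Gamma\Rightarrow\varphi$ and $\Delta,\varphi\Rightarrow E$ infer $\Gamma,\Delta\Rightarrow E$; $\varphi$ is the cut formula), and a set of canonical right- and left-introduction rules. $\mathcal{S}\vdash^{seq}_{\mathbf G}s$ means $s$ is derivable in $\mathbf G$ from the sequents of $\mathcal S$ used as extra axioms. An $\mathcal{S}$-proof is a proof in which the cut formula of every cut occurs in (some sequent of) $\mathcal S$. Coherence. A classical assignment $u$ satisfies a clause $\Pi\Rightarrow E$ iff $u(p)=f$ for some $p\in\Pi$ or $E=\{q\}$ with $u(q)=t$; a set of clauses is classically inconsistent iff no assignment satisfies all of them. $\mathbf G$ is coherent iff for every connective $\diamond$, whenever $\mathbf G$ contains a left rule $\langle S_1,S_2\rangle/\diamond(p_1,\dots,p_n)\Rightarrow$ and a right rule $S_3/\Rightarrow\diamond(p_1,\dots,p_n)$, the set $S_1\cup S_2\cup S_3$ is classically inconsistent. *)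

theory Defs
  imports Main
begin

text \<open>
  A propositional language is given by its connectives together with their arities:
  \<open>L c = None\<close> means that \<open>c\<close> is not a connective of the language.
  The atoms \<open>p\<^sub>1, p\<^sub>2, \<dots>\<close> are numbered from 0 here, so \<open>Atom i\<close> is the atom with index \<open>i + 1\<close>.
\<close>

type_synonym 'c language = "'c \<Rightarrow> nat option"

datatype 'c fm = Atom nat | Con 'c "'c fm list"

inductive_set formulas :: "'c language \<Rightarrow> 'c fm set" for L where
  atom: "Atom i \<in> formulas L"
| con: "L c = Some (length fs) \<Longrightarrow> \<forall>\<phi>\<in>set fs. \<phi> \<in> formulas L \<Longrightarrow> Con c fs \<in> formulas L"

text \<open>
  The pair \<open>(\<Gamma>, E)\<close> is the sequent with left side \<open>\<Gamma>\<close> and right side \<open>set_option E\<close>,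
  a set with at most one element. Clauses are sequents over atom indices.
\<close>

type_synonym 'a sequent = "'a set \<times> 'a option"

type_synonym clause = "nat sequent"

definition sequents :: "'c language \<Rightarrow> 'c fm sequent set" where
  "sequents L = {(\<Gamma>, E). finite \<Gamma> \<and> \<Gamma> \<subseteq> formulas L \<and> set_option E \<subseteq> formulas L}"

definition clauses_over :: "nat \<Rightarrow> clause set" where
  "clauses_over n = {(\<Pi>, E). \<Pi> \<subseteq> {..<n} \<and> set_option E \<subseteq> {..<n}}"

definition substitution :: "'c language \<Rightarrow> ('c fm \<Rightarrow> 'c fm) \<Rightarrow> bool" where
  "substitution L \<sigma> \<longleftrightarrow>
     (\<forall>\<phi>\<in>formulas L. \<sigma> \<phi> \<in> formulas L) \<and>
     (\<forall>c fs. Con c fs \<in> formulas L \<longrightarrow> \<sigma> (Con c fs) = Con c (map \<sigma> fs))"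

text \<open>
  A right rule is \<open>(c, R)\<close> with \<open>R\<close> its set of premises. A left rule is \<open>(c, H, T)\<close> with
  \<open>H\<close> the set of its hard premises and \<open>T\<close> the set of the left sides of its soft premises,
  whose right sides are all empty. Being fixed by \<open>c\<close>, the conclusions are not recorded.
\<close>

record 'c system =
  right_rules :: "('c \<times> clause set) set"
  left_rules :: "('c \<times> clause set \<times> nat set set) set"

definition canonical_system :: "'c language \<Rightarrow> 'c system \<Rightarrow> bool" where
  "canonical_system L G \<longleftrightarrow>
     (\<forall>(c, R)\<in>right_rules G. \<exists>n. L c = Some n \<and> finite R \<and> R \<subseteq> clauses_over n) \<and>
     (\<forall>(c, H, T)\<in>left_rules G. \<exists>n. L c = Some n \<and>
        finite H \<and> H \<subseteq> clauses_over n \<and> finite T \<and> (\<forall>\<Sigma>\<in>T. \<Sigma> \<subseteq> {..<n}))"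

definition satisfies :: "(nat \<Rightarrow> bool) \<Rightarrow> clause \<Rightarrow> bool" where
  "satisfies u = (\<lambda>(\<Pi>, E). (\<exists>p\<in>\<Pi>. \<not> u p) \<or> (\<exists>q. E = Some q \<and> u q))"

definition classically_inconsistent :: "clause set \<Rightarrow> bool" where
  "classically_inconsistent C \<longleftrightarrow> \<not> (\<exists>u. \<forall>s\<in>C. satisfies u s)"

definition coherent :: "'c system \<Rightarrow> bool" where
  "coherent G \<longleftrightarrow>
     (\<forall>c H T R. (c, H, T) \<in> left_rules G \<and> (c, R) \<in> right_rules G \<longrightarrow>
        classically_inconsistent (H \<union> (\<lambda>\<Sigma>. (\<Sigma>, None)) ` T \<union> R))"

definition principal :: "'c \<Rightarrow> nat \<Rightarrow> 'c fm" where
  "principal c n = Con c (map Atom [0..<n])"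

text \<open>
  \<open>inference L G k P s\<close>: the sequent \<open>s\<close> follows from the set of premises \<open>P\<close> by one
  application of a rule of \<open>G\<close>. The label \<open>k\<close> is \<open>Some \<phi>\<close> for a cut with cut formula \<open>\<phi>\<close>,
  and \<open>None\<close> for every other rule.
\<close>

inductive inference ::
  "'c language \<Rightarrow> 'c system \<Rightarrow> 'c fm option \<Rightarrow> 'c fm sequent set \<Rightarrow> 'c fm sequent \<Rightarrow> bool"
  for L G where
  identity: "\<phi> \<in> formulas L \<Longrightarrow> inference L G None {} ({\<phi>}, Some \<phi>)"
| weakening_left: "(\<Gamma>, E) \<in> sequents L \<Longrightarrow> finite \<Delta> \<Longrightarrow> \<Delta> \<subseteq> formulas L \<Longrightarrow>
    inference L G None {(\<Gamma>, E)} (\<Gamma> \<union> \<Delta>, E)"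
| weakening_right: "(\<Gamma>, None) \<in> sequents L \<Longrightarrow> \<psi> \<in> formulas L \<Longrightarrow>
    inference L G None {(\<Gamma>, None)} (\<Gamma>, Some \<psi>)"
| cut: "(\<Gamma>, Some \<phi>) \<in> sequents L \<Longrightarrow> (insert \<phi> \<Delta>, E) \<in> sequents L \<Longrightarrow>
    inference L G (Some \<phi>) {(\<Gamma>, Some \<phi>), (insert \<phi> \<Delta>, E)} (\<Gamma> \<union> \<Delta>, E)"
| right: "(c, R) \<in> right_rules G \<Longrightarrow> L c = Some n \<Longrightarrow> substitution L \<sigma> \<Longrightarrow>
    finite \<Gamma> \<Longrightarrow> \<Gamma> \<subseteq> formulas L \<Longrightarrow>
    inference L G None
      ((\<lambda>(\<Pi>, F). (\<Gamma> \<union> \<sigma> ` Atom ` \<Pi>, map_option (\<sigma> \<circ> Atom) F)) ` R)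
      (\<Gamma>, Some (\<sigma> (principal c n)))"
| left: "(c, H, T) \<in> left_rules G \<Longrightarrow> L c = Some n \<Longrightarrow> substitution L \<sigma> \<Longrightarrow>
    (\<Gamma>, E) \<in> sequents L \<Longrightarrow>
    inference L G None
      ((\<lambda>(\<Pi>, F). (\<Gamma> \<union> \<sigma> ` Atom ` \<Pi>, map_option (\<sigma> \<circ> Atom) F)) ` H \<union>
       (\<lambda>\<Sigma>. (\<Gamma> \<union> \<sigma> ` Atom ` \<Sigma>, E)) ` T)
      (insert (\<sigma> (principal c n)) \<Gamma>, E)"

text \<open>
  Proofs are finite trees. An inner node carries its conclusion, the label of the inference
  (see above) and the proofs of the premises.
\<close>

datatype 'c tree =
  Assumption (concl: "'c fm sequent")
| Inference (concl: "'c fm sequent") "'c fm option" "'c tree list"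

inductive is_proof :: "'c language \<Rightarrow> 'c system \<Rightarrow> 'c fm sequent set \<Rightarrow> 'c tree \<Rightarrow> bool"
  for L G S where
  assumption: "s \<in> S \<Longrightarrow> is_proof L G S (Assumption s)"
| inference: "inference L G k (concl ` set ts) s \<Longrightarrow> \<forall>t\<in>set ts. is_proof L G S t \<Longrightarrow>
    is_proof L G S (Inference s k ts)"

definition derivable :: "'c language \<Rightarrow> 'c system \<Rightarrow> 'c fm sequent set \<Rightarrow> 'c fm sequent \<Rightarrow> bool" where
  "derivable L G S s \<longleftrightarrow> (\<exists>t. is_proof L G S t \<and> concl t = s)"

primrec cut_formulas :: "'c tree \<Rightarrow> 'c fm set" where
  "cut_formulas (Assumption s) = {}"
| "cut_formulas (Inference s k ts) = set_option k \<union> \<Union> (set (map cut_formulas ts))"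

definition occurring :: "'c fm sequent set \<Rightarrow> 'c fm set" where
  "occurring S = (\<Union>(\<Gamma>, E)\<in>S. \<Gamma> \<union> set_option E)"

definition S_proof :: "'c language \<Rightarrow> 'c system \<Rightarrow> 'c fm sequent set \<Rightarrow> 'c tree \<Rightarrow> bool" where
  "S_proof L G S t \<longleftrightarrow> is_proof L G S t \<and> cut_formulas t \<subseteq> occurring S"

definition strong_cut_elimination :: "'c language \<Rightarrow> 'c system \<Rightarrow> bool" where
  "strong_cut_elimination L G \<longleftrightarrow>
     (\<forall>S s. S \<subseteq> sequents L \<and> s \<in> sequents L \<and> derivable L G S s \<longrightarrow>
        (\<exists>t. S_proof L G S t \<and> concl t = s))"

end

theory Submission
  imports Defs
begin

text \<open>
  A cut on \<open>\<phi>\<close> with \<open>\<phi>\<close> not occurring in \<open>S\<close> is permuted upwards, first in the proof of its left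
  premise and then in that of its right premise, until \<open>\<phi>\<close> is principal on both sides; the
  assumptions are no obstacle, since \<open>\<phi>\<close> does not occur in them. For a principal cut in the context
  \<open>\<Theta>\<close>, let \<open>u\<close> be the assignment making true exactly those \<open>p\<close> for which \<open>\<Theta> \<Rightarrow> \<sigma>(p)\<close> has an
  \<open>S\<close>-proof. By coherence \<open>u\<close> falsifies a premise of one of the two rules: its body is then provable
  from \<open>\<Theta>\<close> and its head is not. Cutting the body away, which involves only formulas smaller than \<open>\<phi>\<close>,
  excludes a nonempty head, and otherwise leaves the desired sequent.
\<close>

section \<open>Derivability with restricted cut formulas\<close>

text \<open>Provability without trees, \<open>C\<close> bounding the permitted cut formulas:
  \<open>UNIV\<close> gives plain derivability, \<open>occurring S\<close> gives
  \<open>S\<close>-proofs. Rule induction then handles bare sets of premises.\<close>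

inductive derives ::
  "'c language \<Rightarrow> 'c system \<Rightarrow> 'c fm sequent set \<Rightarrow> 'c fm set \<Rightarrow> 'c fm sequent \<Rightarrow> bool"
  for L G S C where
  assumption: "s \<in> S \<Longrightarrow> derives L G S C s"
| inference: "inference L G k P s \<Longrightarrow> set_option k \<subseteq> C \<Longrightarrow> \<forall>p\<in>P. derives L G S C p \<Longrightarrow>
    derives L G S C s"

lemma derives_if_is_proof:
  "is_proof L G S t \<Longrightarrow> cut_formulas t \<subseteq> C \<Longrightarrow> derives L G S C (concl t)"
proof (induction rule: is_proof.induct)
  case (assumption s)
  then show ?case by (simp add: derives.assumption)
next
  case (inference k ts s)
  then have "\<forall>p\<in>concl ` set ts. derives L G S C p" by auto
  moreover have "set_option k \<subseteq> C" using inference.prems by simp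
  ultimately show ?case using inference.hyps derives.inference by fastforce
qed

text \<open>A tree node lists its premises, so returning from \<open>derives\<close> to trees needs
  finitely many of them.\<close>

lemma finite_premises:
  assumes "canonical_system L G" and "inference L G k P s"
  shows "finite P"
  using assms(2)
proof cases
  case (right c R n \<sigma> \<Gamma>)
  then have "finite R" using assms(1) by (fastforce simp: canonical_system_def)
  then show ?thesis using right by simp
next
  case (left c H T n \<sigma> \<Gamma> E)
  then have "finite H" "finite T" using assms(1) by (fastforce simp: canonical_system_def)+
  then show ?thesis using left by simp
qed auto

lemma ex_proof_if_derives:
  assumes "canonical_system L G" and "derives L G S C s"
  shows "\<exists>t. is_proof L G S t \<and> cut_formulas t \<subseteq> C \<and> concl t = s"
  using assms(2)
proof (induction rule: derives.induct)
  case (assumption s)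
  then show ?case by (intro exI[of _ "Assumption s"]) (simp add: is_proof.assumption)
next
  case (inference k P s)
  then obtain f where f: "\<forall>p\<in>P. is_proof L G S (f p) \<and> cut_formulas (f p) \<subseteq> C \<and> concl (f p) = p"
    by metis
  obtain ps where ps: "set ps = P"
    using finite_list finite_premises[OF assms(1) inference.hyps(1)] by blast
  have "concl ` set (map f ps) = P" using f ps by (force simp: image_image)
  then have "is_proof L G S (Inference s k (map f ps))"
    using inference.hyps f ps by (intro is_proof.inference) auto
  moreover have "cut_formulas (Inference s k (map f ps)) \<subseteq> C"
    using inference.hyps f ps by auto
  ultimately show ?case by (intro exI[of _ "Inference s k (map f ps)"]) simp
qed

section \<open>Substitution instances and well-formed sequents\<close>

lemma principal_in_formulas: "L c = Some n \<Longrightarrow> principal c n \<in> formulas L"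
  by (auto simp: principal_def intro!: formulas.con formulas.atom)

lemma substitution_formulas:
  "substitution L \<sigma> \<Longrightarrow> \<phi> \<in> formulas L \<Longrightarrow> \<sigma> \<phi> \<in> formulas L"
  by (simp add: substitution_def)

lemma substitution_principal_formulas:
  "substitution L \<sigma> \<Longrightarrow> L c = Some n \<Longrightarrow> \<sigma> (principal c n) \<in> formulas L"
  by (rule substitution_formulas[OF _ principal_in_formulas])

text \<open>Serves to compare instances: equal ones stem from the same connective and from
  substitutions agreeing on the rule's atoms, and the images of these atoms are smaller than the
  instance.\<close>

lemma substitution_principal:
  assumes "substitution L \<sigma>" and "L c = Some n"
  shows "\<sigma> (principal c n) = Con c (map (\<sigma> \<circ> Atom) [0..<n])"
  using assms principal_in_formulas[of L c n] by (simp add: substitution_def principal_def)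

lemma inference_sequents:
  assumes "inference L G k P s"
  shows "s \<in> sequents L"
  using assms
proof cases
  case (right c R n \<sigma> \<Gamma>)
  then show ?thesis
    using substitution_principal_formulas[OF right(6) right(5)]
    by (simp add: sequents_def)
next
  case (left c H T n \<sigma> \<Gamma> E)
  then show ?thesis
    using substitution_principal_formulas[OF left(6) left(5)]
    by (simp add: sequents_def)
qed (auto simp: sequents_def)

abbreviation instance_of ::
    "('c fm \<Rightarrow> 'c fm) \<Rightarrow> 'c fm set \<Rightarrow> clause \<Rightarrow> 'c fm sequent" where
  "instance_of \<sigma> \<Gamma> \<equiv> \<lambda>(\<Pi>, F). (\<Gamma> \<union> \<sigma> ` Atom ` \<Pi>, map_option (\<sigma> \<circ> Atom) F)"

section \<open>Structural rules and cuts over fixed assumptions\<close>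

locale coherent_system =
  fixes L :: "'c language" and G :: "'c system" and S :: "'c fm sequent set"
  assumes canonical: "canonical_system L G"
    and coherent: "coherent G"
    and assumptions: "S \<subseteq> sequents L"
begin

abbreviation D :: "'c fm sequent \<Rightarrow> bool" where
  "D \<equiv> derives L G S (occurring S)"

text \<open>Subtracting \<open>{\<phi>}\<close> removes \<open>\<phi>\<close> from the left side
  entirely and lets it be absent, so upward permutation need not ask whether a context also contains
  \<open>\<phi>\<close>.\<close>

definition cut_admissible :: "'c fm \<Rightarrow> bool" where
  "cut_admissible \<phi> \<longleftrightarrow>
     (\<forall>\<Gamma> \<Delta> E. D (\<Gamma>, Some \<phi>) \<longrightarrow> D (\<Delta>, E) \<longrightarrow> D (\<Gamma> \<union> (\<Delta> - {\<phi>}), E))"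

lemma cutD:
  "cut_admissible \<phi> \<Longrightarrow> D (\<Gamma>, Some \<phi>) \<Longrightarrow> D (\<Delta>, E) \<Longrightarrow> D (\<Gamma> \<union> (\<Delta> - {\<phi>}), E)"
  by (simp add: cut_admissible_def)

lemma sequents_if_D: "D s \<Longrightarrow> s \<in> sequents L"
  by (erule derives.cases) (use assumptions inference_sequents in blast)+

lemma D_finite: "D (\<Gamma>, E) \<Longrightarrow> finite \<Gamma>"
  and D_left: "D (\<Gamma>, E) \<Longrightarrow> \<Gamma> \<subseteq> formulas L"
  and D_right: "D (\<Gamma>, E) \<Longrightarrow> set_option E \<subseteq> formulas L"
  using sequents_if_D[of "(\<Gamma>, E)"] by (auto simp: sequents_def)

lemma weaken_left:
  assumes "D (\<Gamma>, E)" and "\<Gamma> \<subseteq> \<Gamma>'" and "finite \<Gamma>'" and "\<Gamma>' \<subseteq> formulas L"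
  shows "D (\<Gamma>', E)"
proof -
  have "inference L G None {(\<Gamma>, E)} (\<Gamma> \<union> \<Gamma>', E)"
    using assms sequents_if_D by (intro inference.weakening_left)
  moreover have "\<Gamma> \<union> \<Gamma>' = \<Gamma>'" using assms(2) by blast
  ultimately show ?thesis using assms(1) derives.inference[where k = None] by fastforce
qed

lemma weaken_right:
  assumes "D (\<Gamma>, None)" and "set_option E \<subseteq> formulas L"
  shows "D (\<Gamma>, E)"
proof (cases E)
  case (Some \<psi>)
  then have "inference L G None {(\<Gamma>, None)} (\<Gamma>, Some \<psi>)"
    using assms sequents_if_D by (intro inference.weakening_right) auto
  then show ?thesis using Some assms(1) derives.inference[where k = None] by fastforce
qed (use assms in simp)

lemma cut_admissible_occurring:
  assumes "\<phi> \<in> occurring S"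
  shows "cut_admissible \<phi>"
  unfolding cut_admissible_def
proof (intro allI impI)
  fix \<Gamma> \<Delta> E assume D: "D (\<Gamma>, Some \<phi>)" "D (\<Delta>, E)"
  \<comment> \<open>The cut rule wants \<open>\<phi>\<close> on the left; weakening supplies it if
    \<open>\<Delta>\<close> lacks it.\<close>
  have D': "D (insert \<phi> (\<Delta> - {\<phi>}), E)"
    using D by (intro weaken_left[OF D(2)]) (auto dest: D_finite D_left D_right)
  then have "inference L G (Some \<phi>) {(\<Gamma>, Some \<phi>), (insert \<phi> (\<Delta> - {\<phi>}), E)} (\<Gamma> \<union> (\<Delta> - {\<phi>}), E)"
    using D sequents_if_D by (intro inference.cut)
  then show "D (\<Gamma> \<union> (\<Delta> - {\<phi>}), E)"
    using D(1) D' assms by (rule_tac derives.inference) auto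
qed

text \<open>The formulas of \<open>A\<close> are cut away one at a time. Each cut brings in only the
  context \<open>\<Gamma>\<close>, which is already there, so contraction comes for free.\<close>

lemma multicut:
  assumes "finite A" and "\<forall>a\<in>A. cut_admissible a \<and> D (\<Gamma>, Some a)"
    and "finite \<Gamma>" and "\<Gamma> \<subseteq> formulas L" and "D (\<Gamma> \<union> A, E)"
  shows "D (\<Gamma>, E)"
  using assms(1,2,5)
proof (induction A)
  case (insert a A)
  have "D (\<Gamma> \<union> (\<Gamma> \<union> insert a A - {a}), E)"
    using insert.prems by (intro cutD) auto
  then have "D (\<Gamma> \<union> A, E)"
    by (rule weaken_left) (use insert.prems insert.hyps assms(3,4) D_left in auto)
  then show ?case using insert by blast
qed simp

section \<open>Rule applications and their instantiated premises\<close>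

lemma D_rightI:
  assumes "(c, R) \<in> right_rules G" and "L c = Some n" and "substitution L \<sigma>"
    and "finite \<Gamma>" and "\<Gamma> \<subseteq> formulas L" and "\<forall>r\<in>R. D (instance_of \<sigma> \<Gamma> r)"
  shows "D (\<Gamma>, Some (\<sigma> (principal c n)))"
  using assms by (intro derives.inference[OF inference.right]) auto

lemma D_leftI:
  assumes "(c, H, T) \<in> left_rules G" and "L c = Some n" and "substitution L \<sigma>"
    and "(\<Gamma>, E) \<in> sequents L"
    and "\<forall>h\<in>H. D (instance_of \<sigma> \<Gamma> h)" and "\<forall>\<Sigma>\<in>T. D (\<Gamma> \<union> \<sigma> ` Atom ` \<Sigma>, E)"
  shows "D (insert (\<sigma> (principal c n)) \<Gamma>, E)"
  using assms by (intro derives.inference[OF inference.left]) auto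

lemma right_rule_over:
  "(c, R) \<in> right_rules G \<Longrightarrow> L c = Some n \<Longrightarrow> R \<subseteq> clauses_over n"
  using canonical by (fastforce simp: canonical_system_def)

lemma left_rule_over:
  assumes "(c, H, T) \<in> left_rules G" and "L c = Some n"
  shows "H \<subseteq> clauses_over n" and "\<forall>\<Sigma>\<in>T. \<Sigma> \<subseteq> {..<n}"
  using canonical assms by (fastforce simp: canonical_system_def)+

lemma finite_instance:
  assumes "substitution L \<sigma>" and "finite \<Theta>" and "\<Theta> \<subseteq> formulas L" and "\<Pi> \<subseteq> {..<n::nat}"
  shows "finite (\<Theta> \<union> \<sigma> ` Atom ` \<Pi>)" and "\<Theta> \<union> \<sigma> ` Atom ` \<Pi> \<subseteq> formulas L"
  using assms finite_subset[of \<Pi>] substitution_formulas[OF assms(1) formulas.atom] by auto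

text \<open>Moves the premises of a rule into a larger context, such as the one shared by both sides
  of a cut.\<close>

lemma weaken_instance:
  assumes "D (instance_of \<sigma> \<Gamma> r)" and "r \<in> clauses_over n" and "substitution L \<sigma>"
    and "\<Gamma> \<subseteq> \<Theta>" and "finite \<Theta>" and "\<Theta> \<subseteq> formulas L"
  shows "D (instance_of \<sigma> \<Theta> r)"
proof -
  obtain \<Pi> F where r: "r = (\<Pi>, F)" by force
  then have "\<Pi> \<subseteq> {..<n}" using assms(2) by (simp add: clauses_over_def)
  note fin = finite_instance[OF assms(3,5,6) this]
  have "D (\<Gamma> \<union> \<sigma> ` Atom ` \<Pi>, map_option (\<sigma> \<circ> Atom) F)" using assms(1) r by simp
  from weaken_left[OF this _ fin] show ?thesis using assms(4) r by auto
qed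

section \<open>Cuts principal on both sides\<close>

text \<open>The one place where coherence enters. Both rules are taken under one substitution and in
  one context, so their premises can be read as clauses under one assignment.\<close>

lemma principal_cut:
  assumes right: "(c, R) \<in> right_rules G" and left: "(c, H, T) \<in> left_rules G"
    and n: "L c = Some n" and \<sigma>: "substitution L \<sigma>"
    and \<Theta>: "(\<Theta>, E) \<in> sequents L"
    and R: "\<forall>r\<in>R. D (instance_of \<sigma> \<Theta> r)"
    and H: "\<forall>h\<in>H. D (instance_of \<sigma> \<Theta> h)"
    and T: "\<forall>\<Sigma>\<in>T. D (\<Theta> \<union> \<sigma> ` Atom ` \<Sigma>, E)"
    and adm: "\<forall>i<n. cut_admissible (\<sigma> (Atom i))"
  shows "D (\<Theta>, E)"
proof -
  define u where "u p \<longleftrightarrow> D (\<Theta>, Some (\<sigma> (Atom p)))" for p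
  have fin: "finite \<Theta>" "\<Theta> \<subseteq> formulas L" "set_option E \<subseteq> formulas L"
    using \<Theta> by (auto simp: sequents_def)
  \<comment> \<open>If \<open>u\<close> makes the whole body true, each body formula is provable
    from \<open>\<Theta>\<close> and can be cut away.\<close>
  have resolve: "D (\<Theta>, F)"
    if "D (\<Theta> \<union> \<sigma> ` Atom ` \<Pi>, F)" "\<Pi> \<subseteq> {..<n}" "\<forall>p\<in>\<Pi>. u p" for \<Pi> F
    using that adm fin finite_subset[of \<Pi>]
    by (intro multicut[of "\<sigma> ` Atom ` \<Pi>" \<Theta> F]) (auto simp: u_def)
  have "classically_inconsistent (H \<union> (\<lambda>\<Sigma>. (\<Sigma>, None)) ` T \<union> R)"
    using coherent left right by (auto simp: coherent_def)
  then obtain s where s: "s \<in> H \<union> (\<lambda>\<Sigma>. (\<Sigma>, None)) ` T \<union> R" and nsat: "\<not> satisfies u s"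
    unfolding classically_inconsistent_def by blast
  obtain \<Pi> F where sF: "s = (\<Pi>, F)" by force
  have body: "\<forall>p\<in>\<Pi>. u p" and head: "F = Some q \<Longrightarrow> \<not> u q" for q
    using nsat sF by (auto simp: satisfies_def)
  show ?thesis
  \<comment> \<open>Hard premises and right-rule premises have their own right side, whereas a soft
    premise carries \<open>E\<close>.\<close>
  proof (cases "s \<in> H \<union> R")
    case True
    then have over: "\<Pi> \<subseteq> {..<n}"
      using right_rule_over[OF right n] left_rule_over(1)[OF left n] sF
      by (auto simp: clauses_over_def)
    have "D (\<Theta> \<union> \<sigma> ` Atom ` \<Pi>, map_option (\<sigma> \<circ> Atom) F)"
      using True R H sF by auto
    then have D: "D (\<Theta>, map_option (\<sigma> \<circ> Atom) F)"
      using resolve over body by blast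
    \<comment> \<open>A head \<open>q\<close> would now be provable from \<open>\<Theta>\<close>,
      making \<open>u q\<close> true although \<open>u\<close> falsifies the clause.\<close>
    then have "F = None" using head by (cases F) (auto simp: u_def)
    then show ?thesis using D weaken_right fin(3) by simp
  next
    case False
    then have "\<Pi> \<in> T" using s sF by auto
    then show ?thesis using T resolve body left_rule_over(2)[OF left n] by blast
  qed
qed

section \<open>Permuting cuts upwards\<close>

text \<open>Induction on the right premise of the cut. The left one is kept as the premises
  \<open>R\<close> of its last right rule, ready for a left rule that introduces the same
  \<open>\<phi>\<close>.\<close>

lemma cut_right_principal:
  assumes right: "(c, R) \<in> right_rules G" and n: "L c = Some n" and \<sigma>: "substitution L \<sigma>"
    and fin: "finite \<Gamma>" "\<Gamma> \<subseteq> formulas L"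
    and R: "\<forall>r\<in>R. D (instance_of \<sigma> \<Gamma> r)"
    and \<phi>: "\<phi> = \<sigma> (principal c n)" and new: "\<phi> \<notin> occurring S"
    and adm: "\<forall>i<n. cut_admissible (\<sigma> (Atom i))"
    and "D s"
  shows "D (\<Gamma> \<union> (fst s - {\<phi>}), snd s)"
  using \<open>D s\<close>
proof (induction rule: derives.induct)
  case (assumption s)
  then have "\<phi> \<notin> fst s" using new by (force simp: occurring_def)
  moreover have D: "D (fst s, snd s)" using assumption derives.assumption by simp
  ultimately show ?case
    using D_finite[OF D] D_left[OF D] fin by (intro weaken_left[OF D]) auto
next
  case (inference k P s)
  have ctx: "finite (\<Gamma> \<union> (\<Delta> - {\<phi>}))" "\<Gamma> \<union> (\<Delta> - {\<phi>}) \<subseteq> formulas L"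
    if "finite \<Delta>" "\<Delta> \<subseteq> formulas L" for \<Delta>
    using that fin by auto
  from inference.hyps(1) show ?case
  proof cases
    case (identity \<psi>)
    show ?thesis
    proof (cases "\<psi> = \<phi>")
      case True
      \<comment> \<open>The axiom on \<open>\<phi>\<close> becomes the left premise of the cut,
        rebuilt from \<open>R\<close>.\<close>
      then show ?thesis using identity D_rightI[OF right n \<sigma> fin R] \<phi> by simp
    next
      case False
      have "D ({\<psi>}, Some \<psi>)"
        using identity by (intro derives.inference[OF inference.identity]) auto
      then show ?thesis using identity False fin by (auto intro: weaken_left)
    qed
  next
    case (weakening_left \<Delta> E \<Delta>')
    then have "D (\<Gamma> \<union> (\<Delta> - {\<phi>}), E)" using inference.IH by auto
    then show ?thesis using weakening_left ctx[of "\<Delta> \<union> \<Delta>'"]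
      by (auto simp: sequents_def intro: weaken_left)
  next
    case (weakening_right \<Delta> \<psi>)
    then have "D (\<Gamma> \<union> (\<Delta> - {\<phi>}), None)" using inference.IH by auto
    then show ?thesis using weakening_right weaken_right by auto
  next
    case (cut \<Delta> \<psi> \<Delta>' E)
    \<comment> \<open>Cuts already present are on formulas of \<open>S\<close>, so they may be
      repeated below the induction hypotheses.\<close>
    then have \<psi>: "\<psi> \<in> occurring S" using inference.hyps by simp
    have D: "D (\<Gamma> \<union> (\<Delta> - {\<phi>}), Some \<psi>)" "D (\<Gamma> \<union> (insert \<psi> \<Delta>' - {\<phi>}), E)"
      using cut inference.IH by auto
    then have "D (\<Gamma> \<union> (\<Delta> - {\<phi>}) \<union> (\<Gamma> \<union> (insert \<psi> \<Delta>' - {\<phi>}) - {\<psi>}), E)"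
      using cutD[OF cut_admissible_occurring[OF \<psi>]] by blast
    then have "D (\<Gamma> \<union> ((\<Delta> \<union> \<Delta>') - {\<phi>}), E)"
      by (rule weaken_left) (use cut fin in \<open>auto simp: sequents_def\<close>)
    then show ?thesis using cut by simp
  next
    case (right c' R' n' \<tau> \<Delta>)
    note c = ctx[OF right(7,8)]
    have "D (instance_of \<tau> (\<Gamma> \<union> (\<Delta> - {\<phi>})) r)" if "r \<in> R'" for r
    proof -
      obtain \<Pi> F where r: "r = (\<Pi>, F)" by force
      then have "\<Pi> \<subseteq> {..<n'}"
        using right_rule_over[OF right(4,5)] that by (auto simp: clauses_over_def)
      note fin' = finite_instance[OF right(6) c this]
      have "D (\<Gamma> \<union> (\<Delta> \<union> \<tau> ` Atom ` \<Pi> - {\<phi>}), map_option (\<tau> \<circ> Atom) F)"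
        using bspec[OF inference.IH[unfolded right(2)], OF imageI[OF that]] r by simp
      \<comment> \<open>The induction hypothesis also deletes \<open>\<phi>\<close> from the
        instantiated body; weakening puts it back where the rule needs it.\<close>
      from weaken_left[OF this _ fin'] show ?thesis using r by auto
    qed
    then show ?thesis using right D_rightI[OF right(4-6) c] by simp
  next
    case (left c' H T n' \<tau> \<Delta> E)
    have \<Delta>: "finite \<Delta>" "\<Delta> \<subseteq> formulas L" "set_option E \<subseteq> formulas L"
      using left by (auto simp: sequents_def)
    note c = ctx[OF \<Delta>(1,2)]
    let ?\<Theta> = "\<Gamma> \<union> (\<Delta> - {\<phi>})"
    have \<Theta>: "(?\<Theta>, E) \<in> sequents L" using c \<Delta> by (simp add: sequents_def)
    have H: "D (instance_of \<tau> ?\<Theta> r)" if "r \<in> H" for r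
    proof -
      obtain \<Pi> F where r: "r = (\<Pi>, F)" by force
      then have "\<Pi> \<subseteq> {..<n'}"
        using left_rule_over[OF left(4,5)] that by (auto simp: clauses_over_def)
      note fin' = finite_instance[OF left(6) c this]
      have "D (\<Gamma> \<union> (\<Delta> \<union> \<tau> ` Atom ` \<Pi> - {\<phi>}), map_option (\<tau> \<circ> Atom) F)"
        using bspec[OF inference.IH[unfolded left(2)], OF UnI1, OF imageI[OF that]] r by simp
      from weaken_left[OF this _ fin'] show ?thesis using r by auto
    qed
    have T: "D (?\<Theta> \<union> \<tau> ` Atom ` \<Sigma>, E)" if "\<Sigma> \<in> T" for \<Sigma>
    proof -
      have "\<Sigma> \<subseteq> {..<n'}" using left_rule_over[OF left(4,5)] that by blast
      note fin' = finite_instance[OF left(6) c this]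
      have "D (\<Gamma> \<union> (\<Delta> \<union> \<tau> ` Atom ` \<Sigma> - {\<phi>}), E)"
        using bspec[OF inference.IH, of "(\<Delta> \<union> \<tau> ` Atom ` \<Sigma>, E)"] left(2) that by simp
      from weaken_left[OF this _ fin'] show ?thesis by auto
    qed
    show ?thesis
    proof (cases "\<tau> (principal c' n') = \<phi>")
      case True
      \<comment> \<open>Only the values of \<open>\<tau>\<close> and \<open>\<sigma>\<close> on the
        first \<open>n\<close> atoms are compared; elsewhere they may differ.\<close>
      then have eq: "Con c' (map (\<tau> \<circ> Atom) [0..<n']) = Con c (map (\<sigma> \<circ> Atom) [0..<n])"
        using \<phi> substitution_principal[OF left(6,5)] substitution_principal[OF \<sigma> n] by simp
      then have c': "c' = c" "n' = n" using left(5) n by auto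
      have agree: "\<forall>i<n. \<tau> (Atom i) = \<sigma> (Atom i)" using eq c' by simp
      \<comment> \<open>The right rule is carried over to the context \<open>?\<Theta>\<close> and
        the substitution \<open>\<tau>\<close> of the left rule. Any further \<open>\<phi>\<close>
        in \<open>\<Delta>\<close> is already gone from the left rule's premises by the induction
        hypothesis.\<close>
      have R': "D (instance_of \<tau> ?\<Theta> r)" if "r \<in> R" for r
      proof -
        have over: "r \<in> clauses_over n" using that right_rule_over[OF right n] by blast
        have "D (instance_of \<sigma> ?\<Theta> r)"
          using weaken_instance[OF _ over \<sigma> _ c] R that by blast
        moreover have "instance_of \<tau> ?\<Theta> r = instance_of \<sigma> ?\<Theta> r"
        proof -
          obtain \<Pi> F where r: "r = (\<Pi>, F)" by force
          then have "\<Pi> \<subseteq> {..<n}" "set_option F \<subseteq> {..<n}"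
            using over by (auto simp: clauses_over_def)
          then have "\<tau> ` Atom ` \<Pi> = \<sigma> ` Atom ` \<Pi>" and
            "map_option (\<tau> \<circ> Atom) F = map_option (\<sigma> \<circ> Atom) F"
            using agree by (auto simp: image_image intro!: image_cong option.map_cong0)
          then show ?thesis using r by simp
        qed
        ultimately show ?thesis by simp
      qed
      have "D (?\<Theta>, E)"
        using principal_cut[OF right left(4)[unfolded c'] n left(6) \<Theta>] R' H T adm agree by simp
      moreover have "\<Gamma> \<union> (insert \<phi> \<Delta> - {\<phi>}) = ?\<Theta>" by blast
      ultimately show ?thesis using left True by simp
    next
      case False
      have "D (insert (\<tau> (principal c' n')) ?\<Theta>, E)"
        using D_leftI[OF left(4-6) \<Theta>] H T by blast
      moreover have "\<Gamma> \<union> (insert (\<tau> (principal c' n')) \<Delta> - {\<phi>}) = insert (\<tau> (principal c' n')) ?\<Theta>"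
        using False by blast
      ultimately show ?thesis using left by simp
    qed
  qed
qed

text \<open>Induction on the left premise of the cut, the right one being fixed;
  \<open>smaller\<close> is the outer induction hypothesis on size.\<close>

lemma cut_left_induct:
  assumes new: "\<phi> \<notin> occurring S"
    and smaller: "\<And>\<psi>. size \<psi> < size \<phi> \<Longrightarrow> cut_admissible \<psi>"
    and "D s" and "snd s = Some \<phi>" and "D (\<Delta>, E)"
  shows "D (fst s \<union> (\<Delta> - {\<phi>}), E)"
  using assms(3,4)
proof (induction rule: derives.induct)
  case (assumption s)
  \<comment> \<open>An assumption with right side \<open>\<phi>\<close> would make
    \<open>\<phi>\<close> occur in \<open>S\<close>.\<close>
  then show ?case using new by (force simp: occurring_def)
next
  case (inference k P s)
  note \<Delta> = D_finite[OF \<open>D (\<Delta>, E)\<close>] D_left[OF \<open>D (\<Delta>, E)\<close>] D_right[OF \<open>D (\<Delta>, E)\<close>]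
  from inference.hyps(1) show ?case
  proof cases
    case (identity \<psi>)
    then show ?thesis using inference.prems \<Delta> \<open>D (\<Delta>, E)\<close>
      by (auto intro: weaken_left)
  next
    case (weakening_left \<Gamma> F \<Gamma>')
    then have "D (\<Gamma> \<union> (\<Delta> - {\<phi>}), E)" using inference.IH inference.prems by auto
    then show ?thesis using weakening_left \<Delta> by (auto simp: sequents_def intro: weaken_left)
  next
    case (weakening_right \<Gamma> \<psi>)
    \<comment> \<open>Here \<open>\<phi>\<close> came from weakening, so the cut is dropped and
      \<open>E\<close> is weakened in instead.\<close>
    then have "D (\<Gamma>, None)" using inference.IH by auto
    then have "D (\<Gamma>, E)" using weaken_right \<Delta> by blast
    then show ?thesis using weakening_right \<Delta> by (auto simp: sequents_def intro: weaken_left)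
  next
    case (cut \<Gamma> \<psi> \<Gamma>' F)
    then have \<psi>: "\<psi> \<in> occurring S" using inference.hyps by simp
    \<comment> \<open>Only the second premise has \<open>\<phi>\<close> on the right, so the first
      is kept unchanged.\<close>
    have "D (\<Gamma>, Some \<psi>)" "D (insert \<psi> \<Gamma>' \<union> (\<Delta> - {\<phi>}), E)"
      using cut inference.IH inference.prems by auto
    then have "D (\<Gamma> \<union> (insert \<psi> \<Gamma>' \<union> (\<Delta> - {\<phi>}) - {\<psi>}), E)"
      using cutD[OF cut_admissible_occurring[OF \<psi>]] by blast
    then have "D (\<Gamma> \<union> \<Gamma>' \<union> (\<Delta> - {\<phi>}), E)"
      by (rule weaken_left) (use cut \<Delta> in \<open>auto simp: sequents_def\<close>)
    then show ?thesis using cut by simp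
  next
    case (right c R n \<sigma> \<Gamma>)
    then have \<phi>: "\<phi> = \<sigma> (principal c n)" using inference.prems by simp
    then have "\<phi> = Con c (map (\<sigma> \<circ> Atom) [0..<n])"
      using substitution_principal right by simp
    then have "size (\<sigma> (Atom i)) < size \<phi>" if "i < n" for i
      using that size_list_estimation'[of "\<sigma> (Atom i)" "map (\<sigma> \<circ> Atom) [0..<n]" "size (\<sigma> (Atom i))" size]
      by auto
    then have adm: "\<forall>i<n. cut_admissible (\<sigma> (Atom i))" using smaller by blast
    have R: "\<forall>r\<in>R. D (instance_of \<sigma> \<Gamma> r)" using right(2) inference.IH by blast
    show ?thesis
      using cut_right_principal[OF right(4-8) R \<phi> new adm \<open>D (\<Delta>, E)\<close>] right by simp
  next
    case (left c H T n \<sigma> \<Gamma> F)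
    let ?\<Theta> = "\<Gamma> \<union> (\<Delta> - {\<phi>})"
    have c: "finite ?\<Theta>" "?\<Theta> \<subseteq> formulas L" using left \<Delta> by (auto simp: sequents_def)
    have \<Theta>: "(?\<Theta>, E) \<in> sequents L" using c \<Delta> by (simp add: sequents_def)
    have H: "D (instance_of \<sigma> ?\<Theta> h)" if "h \<in> H" for h
    proof -
      \<comment> \<open>Hard premises do not inherit the right side \<open>\<phi>\<close>, so
        weakening suffices; the induction hypothesis is for the soft ones.\<close>
      have "D (instance_of \<sigma> \<Gamma> h)" using left(2) inference.IH that by blast
      moreover have "h \<in> clauses_over n" using that left_rule_over(1)[OF left(4,5)] by blast
      ultimately show ?thesis using weaken_instance[OF _ _ left(6) _ c] by blast
    qed
    have T: "D (?\<Theta> \<union> \<sigma> ` Atom ` \<Sigma>, E)" if "\<Sigma> \<in> T" for \<Sigma>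
    proof -
      have "D (\<Gamma> \<union> \<sigma> ` Atom ` \<Sigma> \<union> (\<Delta> - {\<phi>}), E)"
        using bspec[OF inference.IH, of "(\<Gamma> \<union> \<sigma> ` Atom ` \<Sigma>, F)"] left(2,3) inference.prems that
      by simp
      then show ?thesis by (simp add: Un_ac)
    qed
    show ?thesis using D_leftI[OF left(4-6) \<Theta>] H T left by simp
  qed
qed

section \<open>Elimination of all cuts outside \<open>S\<close>\<close>

text \<open>Formulas of \<open>S\<close> need no induction hypothesis, being cut by the rule itself;
  this also covers large formulas of \<open>S\<close> met inside the permutations.\<close>

lemma cut_admissible: "cut_admissible \<phi>"
proof (induction \<phi> rule: measure_induct_rule[of size])
  case (less \<phi>)
  show ?case
  proof (cases "\<phi> \<in> occurring S")
    case False
    then show ?thesis using cut_left_induct[OF False less.IH] by (fastforce simp: cut_admissible_def)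
  qed (rule cut_admissible_occurring)
qed

lemma D_if_derives: "derives L G S UNIV s \<Longrightarrow> D s"
proof (induction rule: derives.induct)
  case (assumption s)
  then show ?case by (rule derives.assumption)
next
  case (inference k P s)
  show ?case
  proof (cases k)
    case None
    then show ?thesis using inference by (auto intro: derives.inference)
  next
    case (Some \<phi>)
    from inference.hyps(1) obtain \<Gamma> \<Delta> E
      where cut: "P = {(\<Gamma>, Some \<phi>), (insert \<phi> \<Delta>, E)}" "s = (\<Gamma> \<union> \<Delta>, E)"
        and seq: "(\<Gamma>, Some \<phi>) \<in> sequents L" "(insert \<phi> \<Delta>, E) \<in> sequents L"
      using Some by (cases rule: inference.cases) auto
    then have "D (\<Gamma> \<union> (insert \<phi> \<Delta> - {\<phi>}), E)"
      using inference.IH cutD[OF cut_admissible, of \<Gamma> \<phi> "insert \<phi> \<Delta>" E] by simp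
    \<comment> \<open>The context \<open>\<Delta>\<close> of the original cut may itself contain
      \<open>\<phi>\<close>, hence the weakening.\<close>
    then have "D (\<Gamma> \<union> \<Delta>, E)"
      by (rule weaken_left) (use seq in \<open>auto simp: sequents_def\<close>)
    then show ?thesis using cut by simp
  qed
qed

end

theorem theorem6p8:
  fixes L :: "'c language" and G :: "'c system"
  assumes "canonical_system L G" and "coherent G"
  shows "strong_cut_elimination L G"
  unfolding strong_cut_elimination_def
proof (intro allI impI, elim conjE)
  fix S :: "'c fm sequent set" and s
  assume S: "S \<subseteq> sequents L" and "derivable L G S s"
  then have "derives L G S UNIV s"
    using derives_if_is_proof by (fastforce simp: derivable_def)
  moreover have "coherent_system L G S" using assms S by unfold_locales
  ultimately have "derives L G S (occurring S) s" using coherent_system.D_if_derives by blast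
  then show "\<exists>t. S_proof L G S t \<and> concl t = s"
    using ex_proof_if_derives[OF assms(1)] by (fastforce simp: S_proof_def)
qed

end
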